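(* Let $n\ge 1$, let $\Gamma_1,\dots,\Gamma_n\in\mathbb{R}$, and for $z_j=x_j+iy_j\in\mathbb{C}$ define $$\mathcal{H}_0(z_1,\dots,z_n) = -\frac{1}{2\pi}\sum_{k<l}\Gamma_k\Gamma_l\log\left|\theta_1\left(i(z_k-z_l), e^{-2\pi}\right)\right| + \frac{1}{4\pi}\sum_{k\ne l}\Gamma_k\Gamma_l\log\left|\theta_1\left(i(z_k-\bar{z}_l- \pi), e^{-2\pi}\right)\right| +\frac{1}{4\pi}\sum_k\Gamma_k^2\log\left|\theta_1\left(2y_k,e^{-2\pi}\right)\right| ,$$ where the second sum is over ordered pairs $(k,l)$ with $k\neq l$. Let $\mu(z)=\bar z+\pi$, and let $\mathcal{H}_0(\mu(z_1),z_2,\dots,z_n)$ denote the value obtained from the expression defining $\mathcal{H}_0(z_1,\dots,z_n)$ by replacing $z_1$ with $\mu(z_1)$ and simultaneously replacing $\Gamma_1$ with $-\Gamma_1$, all other positions and strengths being unchanged. Then, at every configuration $(z_1,\dots,z_n)$ at which all the logarithms in $\mathcal{H}_0(z_1,\dots,z_n)$ are finite, $$\mathcal{H}_0(\mu(z_1), z_2,\ldots,z_n) = \mathcal{H}_0(z_1,\ldots,z_n) - \frac12\sum_{k\ne 1}\Gamma_1\Gamma_k ,$$ where on the right-hand side $\Gamma_1$ denotes the original strength.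
   Context: $\theta_1$ is the Jacobi theta function, given for $z\in\mathbb{C}$ and real $0<q<1$ by $\theta_1(z,q)=2\sum_{m=0}^{\infty}(-1)^m q^{(m+1/2)^2}\sin((2m+1)z)$. The map $\mu$ is the orientation-reversing involution of the torus $\mathbb{C}/(2\pi\mathbb{Z}+i\pi\mathbb{Z})$ whose quotient is the ($\pi$-by-$\pi$ square) Klein bottle. Vortex strengths are twisted scalars: applying $\mu$ to a vortex changes the sign of its strength. *)

theory Defs
  imports Complex_Main
begin

(* The nome q is real, intended for 0 < q < 1 (where the series converges for every z). *)
definition theta1 :: "complex \<Rightarrow> real \<Rightarrow> complex" where
  "theta1 z q =
     2 * (\<Sum>m. (-1) ^ m * of_real (q powr (real m + 1/2)\<^sup>2) * sin (of_nat (2 * m + 1) * z))"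

(* The lift to the complex plane of the involution of the torus C / (2 pi Z + i pi Z)
   whose quotient is the Klein bottle. *)
definition mu :: "complex \<Rightarrow> complex" where
  "mu z = cnj z + of_real pi"

(* Vortices are indexed by 1, ..., n. Since ln 0 = 0 here, this is the intended expression only
   at configurations where none of the theta1 values vanish. *)
definition H0 :: "nat \<Rightarrow> (nat \<Rightarrow> real) \<Rightarrow> (nat \<Rightarrow> complex) \<Rightarrow> real" where
  "H0 n \<Gamma> z =
     - (1 / (2 * pi)) * (\<Sum>(k, l) \<in> {(k, l) \<in> {1..n} \<times> {1..n}. k < l}.
         \<Gamma> k * \<Gamma> l * ln (cmod (theta1 (\<i> * (z k - z l)) (exp (- 2 * pi)))))
     + (1 / (4 * pi)) * (\<Sum>(k, l) \<in> {(k, l) \<in> {1..n} \<times> {1..n}. k \<noteq> l}.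
         \<Gamma> k * \<Gamma> l * ln (cmod (theta1 (\<i> * (z k - cnj (z l) - of_real pi)) (exp (- 2 * pi)))))
     + (1 / (4 * pi)) * (\<Sum>k \<in> {1..n}.
         (\<Gamma> k)\<^sup>2 * ln (cmod (theta1 (of_real (2 * Im (z k))) (exp (- 2 * pi)))))"

end

theory Submission
  imports Defs "HOL-Analysis.Complex_Transcendental"
begin

text \<open>
  Everything rests on three properties of \<open>\<theta>\<^sub>1\<close>: it is odd, it commutes with conjugation, and
  \<open>\<theta>\<^sub>1(z - \<i> ln q, q) = - q\<^sup>-\<^sup>1 exp(- 2 \<i> z) \<theta>\<^sub>1(z, q)\<close>. For \<open>q = exp(- 2 \<pi>)\<close> the last one
  describes the shift by \<open>2 \<pi> \<i>\<close>. Write \<open>a\<close> for the logarithm attached to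
  \<open>\<i> (z\<^sub>l - cnj z\<^sub>1 - \<pi>)\<close> and \<open>b\<close> for the one attached to \<open>\<i> (z\<^sub>1 - z\<^sub>l)\<close>. Applying \<open>\<mu>\<close> to
  \<open>z\<^sub>1\<close> exchanges the roles of \<open>a\<close> and \<open>b\<close>, up to the shifts by \<open>2 \<pi> \<i>\<close>. Before, the vortex
  pair \<open>{1, l}\<close> contributes \<open>\<Gamma>\<^sub>1 \<Gamma>\<^sub>l (a - b + x\<^sub>l - x\<^sub>1) / (2 \<pi>)\<close>, and afterwards
  \<open>\<Gamma>\<^sub>1 \<Gamma>\<^sub>l (a - b - \<pi> + x\<^sub>l - x\<^sub>1) / (2 \<pi>)\<close>.
\<close>

section \<open>Exponential half series of the theta function\<close>

text \<open>The half \<open>m \<ge> 0\<close> of the bilateral exponential series of \<open>\<theta>\<^sub>1\<close>, in the variable \<open>\<i> z\<close>.\<close>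

definition half_theta :: "complex \<Rightarrow> real \<Rightarrow> complex" where
  "half_theta w q =
     (\<Sum>m. (-1) ^ m * of_real (q powr (real m + 1/2)\<^sup>2) * exp (of_nat (2 * m + 1) * w))"

lemma half_theta_coeff_Suc:
  fixes q :: real
  assumes "0 < q"
  shows "q powr (real (Suc m) + 1/2)\<^sup>2 = q powr (real m + 1/2)\<^sup>2 * q ^ (2 * m + 2)"
proof -
  have "(real (Suc m) + 1/2)\<^sup>2 = (real m + 1/2)\<^sup>2 + real (2 * m + 2)"
    by (simp add: power2_eq_square algebra_simps)
  then show ?thesis
    using assms by (simp only: powr_add powr_realpow)
qed

text \<open>Consecutive norms have ratio \<open>q ^ (2 * m + 2) * exp (2 * Re w)\<close>, which
  tends to 0 for every \<open>w\<close>.\<close>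

lemma summable_half_theta:
  fixes w :: complex
  assumes q: "0 < q" "q < 1"
  shows "summable (\<lambda>m. (-1) ^ m * of_real (q powr (real m + 1/2)\<^sup>2) * exp (of_nat (2 * m + 1) * w))"
    (is "summable ?f")
proof -
  have "(\<lambda>m. (q\<^sup>2) ^ m) \<longlonglongrightarrow> 0"
    using q by (intro LIMSEQ_power_zero) (simp add: power_less_one_iff)
  then have "(\<lambda>m. (q\<^sup>2) ^ m * (q\<^sup>2 * exp (2 * Re w))) \<longlonglongrightarrow> 0"
    by (rule tendsto_mult_left_zero)
  \<comment> \<open>Any bound strictly between 0 and 1 would serve the ratio test; 1/2 is a
    convenient one.\<close>
  then have "\<forall>\<^sub>F m in sequentially. (q\<^sup>2) ^ m * (q\<^sup>2 * exp (2 * Re w)) < 1/2"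
    by (rule order_tendstoD) simp
  then obtain N where N: "\<And>m. m \<ge> N \<Longrightarrow> (q\<^sup>2) ^ m * (q\<^sup>2 * exp (2 * Re w)) < 1/2"
    by (auto simp: eventually_sequentially)
  have ratio: "norm (?f (Suc m)) = (q\<^sup>2) ^ m * (q\<^sup>2 * exp (2 * Re w)) * norm (?f m)" for m
  proof -
    have "exp (of_nat (2 * Suc m + 1) * w) = exp (of_nat (2 * m + 1) * w) * exp (2 * w)"
      by (simp add: exp_add [symmetric] algebra_simps)
    moreover have "norm (exp (2 * w)) = exp (2 * Re w)"
      by simp
    moreover have "q ^ (2 * m + 2) = (q\<^sup>2) ^ m * q\<^sup>2"
      by (simp add: power_mult power_add power2_eq_square)
    ultimately show ?thesis
      using q by (simp only: half_theta_coeff_Suc norm_mult norm_power norm_minus_cancel norm_one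
          norm_of_real abs_mult power_one mult_1) (simp add: algebra_simps)
  qed
  show ?thesis
  proof (rule summable_ratio_test)
    show "norm (?f (Suc m)) \<le> 1/2 * norm (?f m)" if "m \<ge> N" for m
      unfolding ratio using N [OF that] by (intro mult_right_mono) auto
  qed simp
qed

text \<open>Euler's formula for the sine in each term; its factor 1/2 cancels the 2 in
  \<open>theta1\<close>.\<close>

lemma theta1_eq_half_theta:
  assumes "0 < q" "q < 1"
  shows "theta1 z q = - \<i> * (half_theta (\<i> * z) q - half_theta (- (\<i> * z)) q)"
proof -
  let ?c = "\<lambda>m. (-1) ^ m * of_real (q powr (real m + 1/2)\<^sup>2) :: complex"
  note s = summable_half_theta [OF assms]
  have "?c m * sin (of_nat (2 * m + 1) * z) = - \<i> / 2 *
      (?c m * exp (of_nat (2 * m + 1) * (\<i> * z)) - ?c m * exp (of_nat (2 * m + 1) * - (\<i> * z)))" for m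
  proof -
    have "sin (k * z) = - \<i> / 2 * (exp (k * (\<i> * z)) - exp (k * - (\<i> * z)))" for k :: complex
      by (simp add: sin_exp_eq' mult.left_commute [of _ k] right_diff_distrib diff_divide_distrib)
    then show ?thesis
      by (simp only: right_diff_distrib mult.left_commute)
  qed
  moreover have "(\<lambda>m. - \<i> / 2 * (?c m * exp (of_nat (2 * m + 1) * (\<i> * z)) -
      ?c m * exp (of_nat (2 * m + 1) * - (\<i> * z)))) sums
      (- \<i> / 2 * (half_theta (\<i> * z) q - half_theta (- (\<i> * z)) q))"
    unfolding half_theta_def by (intro sums_mult sums_diff summable_sums s)
  ultimately have "(\<Sum>m. ?c m * sin (of_nat (2 * m + 1) * z)) =
      - \<i> / 2 * (half_theta (\<i> * z) q - half_theta (- (\<i> * z)) q)"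
    by (simp only: sums_unique [symmetric])
  then show ?thesis
    by (simp add: theta1_def algebra_simps)
qed

lemma half_theta_cnj:
  assumes "0 < q" "q < 1"
  shows "half_theta (cnj w) q = cnj (half_theta w q)"
proof -
  let ?f = "\<lambda>w m. (-1) ^ m * of_real (q powr (real m + 1/2)\<^sup>2) * exp (of_nat (2 * m + 1) * w)"
  have "(\<lambda>m. cnj (?f w m)) sums cnj (half_theta w q)"
    unfolding sums_cnj half_theta_def by (intro summable_sums summable_half_theta assms)
  moreover have "cnj (?f w m) = ?f (cnj w) m" for m
    by (simp add: exp_cnj)
  ultimately show ?thesis
    unfolding half_theta_def by (simp only: sums_iff)
qed

text \<open>The shift by \<open>ln q\<close> multiplies term \<open>m\<close> by
  \<open>q ^ (2 * m + 1)\<close>, and (m + 1/2)^2 + 2m + 1 = (m + 3/2)^2 - 1, so the series moves up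
  by one index. The subtracted summand is the lost term at index 0.\<close>

lemma half_theta_add_ln:
  assumes "0 < q" "q < 1"
  shows "half_theta (w + of_real (ln q)) q =
    - exp (- 2 * w) / of_real q * (half_theta w q - of_real (q powr (1/4)) * exp w)"
proof -
  let ?f = "\<lambda>w m. (-1) ^ m * of_real (q powr (real m + 1/2)\<^sup>2) * exp (of_nat (2 * m + 1) * w)"
  have exp_ln: "exp (of_real (ln q)) = (of_real q :: complex)"
    using assms by (simp add: exp_of_real)
  have "?f (w + of_real (ln q)) m = - exp (- 2 * w) / of_real q * ?f w (Suc m)" for m
  proof -
    have e1: "exp (of_nat (2 * m + 1) * (w + of_real (ln q))) =
        exp (of_nat (2 * m + 1) * w) * of_real q ^ (2 * m + 1)"
      by (simp only: distrib_left exp_add exp_of_nat_mult exp_ln)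
    have e2: "exp (of_nat (2 * Suc m + 1) * w) = exp (of_nat (2 * m + 1) * w) / exp (- 2 * w)"
      by (simp add: exp_diff [symmetric] algebra_simps)
    show ?thesis
      unfolding e1 e2 half_theta_coeff_Suc [OF assms(1)]
      using assms by (simp add: field_simps)
  qed
  then have "half_theta (w + of_real (ln q)) q =
      (\<Sum>m. - exp (- 2 * w) / of_real q * ?f w (Suc m))"
    by (simp add: half_theta_def)
  also have "\<dots> = - exp (- 2 * w) / of_real q * (\<Sum>m. ?f w (Suc m))"
    by (rule suminf_mult, subst summable_Suc_iff) (rule summable_half_theta [OF assms])
  also have "(\<Sum>m. ?f w (Suc m)) = half_theta w q - ?f w 0"
    unfolding half_theta_def by (rule suminf_split_head [OF summable_half_theta [OF assms]])
  finally show ?thesis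
    by (simp add: power2_eq_square)
qed

text \<open>This is \<open>half_theta_add_ln\<close> at \<open>w - of_real (ln q)\<close>, solved
  for the shifted value.\<close>

lemma half_theta_diff_ln:
  assumes "0 < q" "q < 1"
  shows "half_theta (w - of_real (ln q)) q =
    exp w / of_real q * (of_real (q powr (1/4)) - exp w * half_theta w q)"
proof -
  have exp_ln: "exp (of_real (ln q)) = (of_real q :: complex)"
    using assms by (simp add: exp_of_real)
  have e: "exp (w - of_real (ln q)) = exp w / of_real q"
    by (simp add: exp_diff exp_ln)
  have "exp (- 2 * (w - of_real (ln q))) = inverse (exp (w - of_real (ln q)) ^ 2)"
    by (simp add: exp_double [symmetric] exp_minus [symmetric] algebra_simps)
  then have e2: "exp (- 2 * (w - of_real (ln q))) = of_real q ^ 2 / exp w ^ 2"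
    by (simp add: e power_divide)
  have "half_theta w q = - (of_real q / exp w ^ 2) *
      (half_theta (w - of_real (ln q)) q - of_real (q powr (1/4)) * (exp w / of_real q))"
    using half_theta_add_ln [OF assms, of "w - of_real (ln q)"] assms
    unfolding e e2 by (simp add: power2_eq_square)
  also have "\<dots> =
      (of_real (q powr (1/4)) * exp w - of_real q * half_theta (w - of_real (ln q)) q) / exp w ^ 2"
    using assms by (simp add: right_diff_distrib diff_divide_distrib)
  finally show ?thesis
    using assms by (simp add: field_simps power2_eq_square)
qed

section \<open>Symmetries and quasiperiodicity of theta1\<close>

lemma theta1_minus:
  assumes "0 < q" "q < 1"
  shows "theta1 (- z) q = - theta1 z q"
  by (simp add: theta1_eq_half_theta [OF assms] algebra_simps)

lemma theta1_cnj:
  assumes "0 < q" "q < 1"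
  shows "theta1 (cnj z) q = cnj (theta1 z q)"
  using half_theta_cnj [OF assms, of "\<i> * z"] half_theta_cnj [OF assms, of "- (\<i> * z)"]
  by (simp add: theta1_eq_half_theta [OF assms] algebra_simps)

text \<open>One half series loses a boundary term and the other gains one. Both contribute
  \<open>q powr (1/4) * exp (- w) / q\<close> with \<open>w = \<i> * z\<close>, so they cancel in
  the difference.\<close>

lemma theta1_quasiperiodic:
  assumes "0 < q" "q < 1"
  shows "theta1 (z - \<i> * of_real (ln q)) q = - exp (- 2 * \<i> * z) / of_real q * theta1 z q"
proof -
  define w where "w = \<i> * z"
  have [simp]: "\<i> * (z - \<i> * of_real (ln q)) = w + of_real (ln q)"
    by (simp add: w_def algebra_simps)
  have "- w - of_real (ln q) = - (w + of_real (ln q))"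
    by simp
  then have minus: "half_theta (- (w + of_real (ln q))) q =
      exp (- w) / of_real q * (of_real (q powr (1/4)) - exp (- w) * half_theta (- w) q)"
    using half_theta_diff_ln [OF assms, of "- w"] by simp
  have e: "exp (- 2 * w) = exp (- w) * exp (- w)" "exp (- w) * exp w = 1"
    by (simp_all add: exp_add [symmetric])
  have "theta1 (z - \<i> * of_real (ln q)) q =
      - \<i> * (half_theta (w + of_real (ln q)) q - half_theta (- (w + of_real (ln q))) q)"
    by (simp add: theta1_eq_half_theta [OF assms])
  also have "\<dots> = - exp (- 2 * w) / of_real q * (- \<i> * (half_theta w q - half_theta (- w) q))"
    unfolding half_theta_add_ln [OF assms] minus
    using assms e(2) unfolding e(1) by (simp add: field_simps)
  finally show ?thesis
    by (simp add: theta1_eq_half_theta [OF assms] w_def mult.assoc)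
qed

section \<open>Logarithms at the nome exp(-2 pi) and the action of mu\<close>

abbreviation log_theta :: "complex \<Rightarrow> real" where
  "log_theta w \<equiv> ln (cmod (theta1 w (exp (- 2 * pi))))"

lemma log_theta_minus: "log_theta (- w) = log_theta w"
  by (simp add: theta1_minus)

lemma log_theta_cnj: "log_theta (cnj w) = log_theta w"
  by (simp add: theta1_cnj)

text \<open>For this nome \<open>- \<i> * ln q\<close> is \<open>2 * pi * \<i>\<close>. The
  hypothesis lets \<open>ln\<close> split the product, as \<open>ln 0 = 0\<close> would break the
  formula.\<close>

lemma log_theta_shift:
  assumes "theta1 w (exp (- 2 * pi)) \<noteq> 0"
  shows "log_theta (w + 2 * of_real pi * \<i>) = log_theta w + 2 * pi + 2 * Im w"
proof -
  have "theta1 (w + 2 * of_real pi * \<i>) (exp (- 2 * pi)) =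
      - exp (- 2 * \<i> * w) / of_real (exp (- 2 * pi)) * theta1 w (exp (- 2 * pi))"
    using theta1_quasiperiodic [of "exp (- 2 * pi)" w] by (simp add: algebra_simps)
  then have "cmod (theta1 (w + 2 * of_real pi * \<i>) (exp (- 2 * pi))) =
      exp (2 * Im w) / exp (- 2 * pi) * cmod (theta1 w (exp (- 2 * pi)))"
    by (simp only: norm_mult norm_divide norm_minus_cancel norm_exp_eq_Re norm_of_real) simp
  then show ?thesis
    using assms by (simp add: ln_mult ln_div)
qed

text \<open>Conjugation exchanges the two arguments up to a shift by \<open>2 * pi * \<i>\<close>;
  the resulting 2 pi cancels against the -2 pi from the imaginary part.\<close>

lemma log_theta_image_swap:
  assumes "theta1 (\<i> * (v - cnj u - of_real pi)) (exp (- 2 * pi)) \<noteq> 0"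
  shows "log_theta (\<i> * (u - cnj v - of_real pi)) =
    log_theta (\<i> * (v - cnj u - of_real pi)) + 2 * (Re v - Re u)"
proof -
  have "cnj (\<i> * (u - cnj v - of_real pi)) =
      \<i> * (v - cnj u - of_real pi) + 2 * of_real pi * \<i>"
    by (simp add: algebra_simps)
  then show ?thesis
    using log_theta_shift [OF assms] log_theta_cnj [of "\<i> * (u - cnj v - of_real pi)"] by simp
qed

lemma log_theta_mu_diff:
  "log_theta (\<i> * (mu u - v)) = log_theta (\<i> * (v - cnj u - of_real pi))"
  using log_theta_minus [of "\<i> * (mu u - v)"] by (simp add: mu_def algebra_simps)

lemma log_theta_mu_image_left:
  "log_theta (\<i> * (mu u - cnj v - of_real pi)) = log_theta (\<i> * (u - v))"
proof -
  have "\<i> * (mu u - cnj v - of_real pi) = - cnj (\<i> * (u - v))"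
    by (simp add: mu_def algebra_simps)
  then show ?thesis
    by (simp only: log_theta_minus log_theta_cnj)
qed

text \<open>Here \<open>cnj (mu u)\<close> is \<open>u + pi\<close>, so the two translations by pi
  add up instead of cancelling. The resulting 2 pi is the source of the correction term in the
  theorem.\<close>

lemma log_theta_mu_image_right:
  assumes "theta1 (\<i> * (u - v)) (exp (- 2 * pi)) \<noteq> 0"
  shows "log_theta (\<i> * (v - cnj (mu u) - of_real pi)) =
    log_theta (\<i> * (u - v)) + 2 * pi + 2 * (Re u - Re v)"
proof -
  have "\<i> * (v - cnj (mu u) - of_real pi) = - (\<i> * (u - v) + 2 * of_real pi * \<i>)"
    by (simp add: mu_def algebra_simps)
  then show ?thesis
    using log_theta_shift [OF assms] by (simp only: log_theta_minus) simp
qed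

lemma log_theta_mu_self:
  "log_theta (of_real (2 * Im (mu u))) = log_theta (of_real (2 * Im u))"
  using log_theta_minus [of "of_real (2 * Im u)"] by (simp add: mu_def)

section \<open>Separating the pairs that contain vortex 1\<close>

lemma sum_ordered_pairs_split_first:
  fixes f :: "nat \<Rightarrow> nat \<Rightarrow> 'a :: comm_monoid_add"
  assumes "n \<ge> 1"
  shows "(\<Sum>(k, l) \<in> {(k, l) \<in> {1..n} \<times> {1..n}. k < l}. f k l) =
    (\<Sum>l \<in> {1..n} - {1}. f 1 l) + (\<Sum>(k, l) \<in> {(k, l) \<in> {2..n} \<times> {2..n}. k < l}. f k l)"
proof -
  have "{(k, l) \<in> {1..n} \<times> {1..n}. k < l} =
      Pair 1 ` ({1..n} - {1}) \<union> {(k, l) \<in> {2..n} \<times> {2..n}. k < l}"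
    using assms by (auto simp: image_iff)
  moreover have "finite {(k, l) \<in> {2..n} \<times> {2..n}. k < l}"
    by (rule finite_subset [of _ "{2..n} \<times> {2..n}"]) auto
  ultimately show ?thesis
    by (simp add: sum.union_disjoint disjoint_iff image_iff sum.reindex inj_on_def)
qed

text \<open>Index 1 may stand in either place; both orders share one summand, to be matched with the
  single term of the sum over \<open>k < l\<close>.\<close>

lemma sum_distinct_pairs_split_first:
  fixes f :: "nat \<Rightarrow> nat \<Rightarrow> 'a :: comm_monoid_add"
  assumes "n \<ge> 1"
  shows "(\<Sum>(k, l) \<in> {(k, l) \<in> {1..n} \<times> {1..n}. k \<noteq> l}. f k l) =
    (\<Sum>l \<in> {1..n} - {1}. f 1 l + f l 1) +
    (\<Sum>(k, l) \<in> {(k, l) \<in> {2..n} \<times> {2..n}. k \<noteq> l}. f k l)"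
proof -
  let ?L = "Pair 1 ` ({1..n} - {1})" and ?R = "(\<lambda>l. (l, 1)) ` ({1..n} - {1})"
  let ?S = "{(k, l) \<in> {2..n} \<times> {2..n}. k \<noteq> l}"
  have "{(k, l) \<in> {1..n} \<times> {1..n}. k \<noteq> l} = (?L \<union> ?R) \<union> ?S"
    using assms by (auto simp: image_iff)
  moreover have "finite ?S"
    by (rule finite_subset [of _ "{2..n} \<times> {2..n}"]) auto
  moreover have "(?L \<union> ?R) \<inter> ?S = {}" "?L \<inter> ?R = {}"
    by auto
  ultimately show ?thesis
    by (simp add: sum.union_disjoint sum.reindex inj_on_def sum.distrib)
qed

section \<open>Comparison of the Hamiltonians\<close>

theorem lemma2p5:
  fixes n :: nat and \<Gamma> :: "nat \<Rightarrow> real" and z :: "nat \<Rightarrow> complex"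
  assumes "n \<ge> 1"
    and "\<And>k l. k \<in> {1..n} \<Longrightarrow> l \<in> {1..n} \<Longrightarrow> k < l \<Longrightarrow>
           theta1 (\<i> * (z k - z l)) (exp (- 2 * pi)) \<noteq> 0"
    and "\<And>k l. k \<in> {1..n} \<Longrightarrow> l \<in> {1..n} \<Longrightarrow> k \<noteq> l \<Longrightarrow>
           theta1 (\<i> * (z k - cnj (z l) - of_real pi)) (exp (- 2 * pi)) \<noteq> 0"
    and "\<And>k. k \<in> {1..n} \<Longrightarrow> theta1 (of_real (2 * Im (z k))) (exp (- 2 * pi)) \<noteq> 0"
  shows "H0 n (\<Gamma>(1 := - \<Gamma> 1)) (z(1 := mu (z 1))) =
         H0 n \<Gamma> z - 1/2 * (\<Sum>k \<in> {1..n} - {1}. \<Gamma> 1 * \<Gamma> k)"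
proof -
  define I where "I = {1..n} - {1}"
  define P where "P G w k l = G k * G l * log_theta (\<i> * (w k - w l))"
    for G :: "nat \<Rightarrow> real" and w k l
  define Q where "Q G w k l = G k * G l * log_theta (\<i> * (w k - cnj (w l) - of_real pi))"
    for G :: "nat \<Rightarrow> real" and w k l
  define R where "R G w k = (G k)\<^sup>2 * log_theta (of_real (2 * Im (w k)))"
    for G :: "nat \<Rightarrow> real" and w k
  \<comment> \<open>The self-interaction of vortex 1 may stay in \<open>rest\<close>: its strength
    enters squared and \<open>mu\<close> only changes the sign of \<open>Im\<close>.\<close>
  define rest where "rest G w =
      - (1 / (2 * pi)) * (\<Sum>(k, l) \<in> {(k, l) \<in> {2..n} \<times> {2..n}. k < l}. P G w k l)
      + (1 / (4 * pi)) * (\<Sum>(k, l) \<in> {(k, l) \<in> {2..n} \<times> {2..n}. k \<noteq> l}. Q G w k l)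
      + (1 / (4 * pi)) * (\<Sum>k \<in> {1..n}. R G w k)"
    for G w
  define T where "T G w l =
      - (1 / (2 * pi)) * P G w 1 l + (1 / (4 * pi)) * (Q G w 1 l + Q G w l 1)"
    for G w l
  have H0_split: "H0 n G w = (\<Sum>l \<in> I. T G w l) + rest G w" for G w
  proof -
    have "H0 n G w =
        - (1 / (2 * pi)) * (\<Sum>(k, l) \<in> {(k, l) \<in> {1..n} \<times> {1..n}. k < l}. P G w k l)
        + (1 / (4 * pi)) * (\<Sum>(k, l) \<in> {(k, l) \<in> {1..n} \<times> {1..n}. k \<noteq> l}. Q G w k l)
        + (1 / (4 * pi)) * (\<Sum>k \<in> {1..n}. R G w k)"
      unfolding H0_def P_def Q_def R_def ..
    then show ?thesis
      unfolding sum_ordered_pairs_split_first [OF assms(1)]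
        sum_distinct_pairs_split_first [OF assms(1)] rest_def T_def I_def
      by (simp only: sum.distrib sum_distrib_left distrib_left)
  qed
  let ?G = "\<Gamma>(1 := - \<Gamma> 1)" and ?w = "z(1 := mu (z 1))"
  have rest_mu: "rest ?G ?w = rest \<Gamma> z"
  proof -
    have "P ?G ?w k l = P \<Gamma> z k l" "Q ?G ?w k l = Q \<Gamma> z k l" if "k \<ge> 2" "l \<ge> 2" for k l
      using that by (simp_all add: P_def Q_def)
    moreover have "R ?G ?w k = R \<Gamma> z k" for k
      unfolding R_def using log_theta_mu_self [of "z 1"] by (cases "k = 1") simp_all
    ultimately show ?thesis
      unfolding rest_def
      by (intro arg_cong2 [where f = "(+)"] arg_cong2 [where f = "(*)"] refl sum.cong) auto
  qed
  have T_mu: "T ?G ?w l = T \<Gamma> z l - 1/2 * (\<Gamma> 1 * \<Gamma> l)" if "l \<in> I" for l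
  proof -
    have l: "l \<in> {1..n}" "1 < l" "1 \<in> {1..n}" "l \<noteq> 1"
      using that assms(1) by (auto simp: I_def)
    define a where "a = log_theta (\<i> * (z l - cnj (z 1) - of_real pi))"
    define b where "b = log_theta (\<i> * (z 1 - z l))"
    define x where "x = Re (z l) - Re (z 1)"
    note defs = a_def [symmetric] b_def [symmetric] x_def [symmetric]
    \<comment> \<open>The roles of \<open>a\<close> and \<open>b\<close> are exchanged, and the
      minus signs come from the reversed strength.\<close>
    have "P ?G ?w 1 l = - \<Gamma> 1 * \<Gamma> l * a" "Q ?G ?w 1 l = - \<Gamma> 1 * \<Gamma> l * b"
      unfolding P_def Q_def using l(4)
      by (simp_all only: fun_upd_same fun_upd_other log_theta_mu_diff log_theta_mu_image_left
          defs not_False_eq_True)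
    moreover have "Q ?G ?w l 1 = - (\<Gamma> 1 * \<Gamma> l * (b + 2 * pi - 2 * x))"
    proof -
      have "log_theta (\<i> * (z l - cnj (mu (z 1)) - of_real pi)) = b + 2 * pi - 2 * x"
        unfolding log_theta_mu_image_right [OF assms(2) [OF l(3,1,2)]] b_def x_def
        by (simp only: right_diff_distrib)
      then show ?thesis
        unfolding Q_def using l(4) by (simp only: fun_upd_same fun_upd_other) simp
    qed
    moreover have "P \<Gamma> z 1 l = \<Gamma> 1 * \<Gamma> l * b" "Q \<Gamma> z l 1 = \<Gamma> 1 * \<Gamma> l * a"
      unfolding P_def Q_def a_def b_def by simp_all
    moreover have "Q \<Gamma> z 1 l = \<Gamma> 1 * \<Gamma> l * (a + 2 * x)"
      unfolding Q_def using log_theta_image_swap [OF assms(3) [OF l(1,3,4)]]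
      by (simp only: defs)
    \<comment> \<open>The \<open>x\<close> terms agree on both sides, so only -2 pi / (4 pi) = -1/2
      remains.\<close>
    ultimately show ?thesis
      unfolding T_def by (simp only:) (simp add: field_simps)
  qed
  have "(\<Sum>l \<in> I. T ?G ?w l) = (\<Sum>l \<in> I. T \<Gamma> z l) - 1/2 * (\<Sum>l \<in> I. \<Gamma> 1 * \<Gamma> l)"
    by (simp only: T_mu sum_subtractf sum_distrib_left cong: sum.cong)
  then show ?thesis
    unfolding H0_split rest_mu by (simp add: I_def)
qed

end
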